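(* Let $\Sigma$ be a connected graph, $s$ a positive integer, and $G\leqslant \mathrm{Aut}(\Sigma)$. Then the subdivision graph $S(\Sigma)$ is locally $(G,s)$-arc transitive if and only if $\Sigma$ is $(G,\lceil\frac{s+1}{2}\rceil)$-arc transitive.
   Context: Graphs are simple and undirected; $V(\Sigma)$ and $E(\Sigma)$ denote the vertex set and edge set (edges are unordered pairs of vertices). The subdivision graph $S(\Sigma)$ has vertex set $V(\Sigma)\cup E(\Sigma)$ and edge set $\{\{x,e\}\mid x\in V(\Sigma), e\in E(\Sigma), x\in e\}$. $\mathrm{Aut}(\Sigma)$ acts naturally on $V(\Sigma)\cup E(\Sigma)$ preserving incidence, so $G\leqslant\mathrm{Aut}(\Sigma)$ acts on $S(\Sigma)$ by automorphisms. For a graph $\Gamma$ and a positive integer $i$, an $i$-arc of $\Gamma$ is an $(i+1)$-tuple $(v_0,\dots,v_i)$ of vertices with $\{v_{j-1},v_j\}\in E(\Gamma)$ for $1\leqslant j\leqslant i$ and $v_{j-1}\ne v_{j+1}$ for $1\leqslant j\leqslant i-1$. Let $G$ act on the connected graph $\Gamma$ by automorphisms. $\Gamma$ is $(G,s)$-arc transitive if $\Gamma$ has at least one $s$-arc and, for each $1\leqslant i\leqslant s$, $G$ is transitive on the set of $i$-arcs of $\Gamma$. $\Gamma$ is locally $(G,s)$-arc transitive if, for every vertex $v$ of $\Gamma$ and each $1\leqslant i\leqslant s$, the stabiliser $G_v$ is transitive on the set of $i$-arcs of $\Gamma$ with initial vertex $v$ (vacuously true if this set is empty), and for some vertex $v$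 there is an $s$-arc with initial vertex $v$.
   Formalization: The case where Σ has exactly two vertices (Σ = K_2) and s = 2 is excluded, because there the claim fails for G = Aut(K_2): S(K_2) is locally (G,2)-arc transitive but K_2 has no 2-arc. *)

theory Defs
  imports Complex_Main "HOL-Algebra.Bij" "HOL-Algebra.Group_Action"
begin

record 'a graph =
  vertices :: "'a set"
  edges :: "'a set set"

definition simple_graph :: "'a graph \<Rightarrow> bool" where
  "simple_graph \<Gamma> \<longleftrightarrow>
     (\<forall>e\<in>edges \<Gamma>. \<exists>x\<in>vertices \<Gamma>. \<exists>y\<in>vertices \<Gamma>. x \<noteq> y \<and> e = {x, y})"

definition connected_graph :: "'a graph \<Rightarrow> bool" where
  "connected_graph \<Gamma> \<longleftrightarrow>
     (\<forall>u\<in>vertices \<Gamma>. \<forall>v\<in>vertices \<Gamma>. (u, v) \<in> {(x, y). {x, y} \<in> edges \<Gamma>}\<^sup>*)"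

text \<open>
  Elements of \<open>Bij V\<close> are functions that are undefined outside \<open>V\<close>, so automorphisms
  are determined by their values on the vertices.
\<close>

definition graph_Aut :: "'a graph \<Rightarrow> ('a \<Rightarrow> 'a) monoid" where
  "graph_Aut \<Gamma> = BijGroup (vertices \<Gamma>)
     \<lparr>carrier := {g \<in> Bij (vertices \<Gamma>).
        \<forall>x\<in>vertices \<Gamma>. \<forall>y\<in>vertices \<Gamma>. {g x, g y} \<in> edges \<Gamma> \<longleftrightarrow> {x, y} \<in> edges \<Gamma>}\<rparr>"

definition subdivision :: "'a graph \<Rightarrow> ('a + 'a set) graph" where
  "subdivision \<Gamma> =
     \<lparr>vertices = vertices \<Gamma> <+> edges \<Gamma>,
      edges = {{Inl x, Inr e} | x e. x \<in> vertices \<Gamma> \<and> e \<in> edges \<Gamma> \<and> x \<in> e}\<rparr>"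

definition subdivision_action ::
    "'a graph \<Rightarrow> ('a \<Rightarrow> 'a) \<Rightarrow> ('a + 'a set) \<Rightarrow> ('a + 'a set)" where
  "subdivision_action \<Gamma> g = restrict (map_sum g (image g)) (vertices (subdivision \<Gamma>))"

text \<open>The \<open>i\<close>-arc \<open>(v\<^sub>0, \<dots>, v\<^sub>i)\<close> is the list of length \<open>i + 1\<close>.\<close>

definition arcs :: "'a graph \<Rightarrow> nat \<Rightarrow> 'a list set" where
  "arcs \<Gamma> i = {p. length p = i + 1 \<and> set p \<subseteq> vertices \<Gamma> \<and>
     (\<forall>j. 1 \<le> j \<and> j \<le> i \<longrightarrow> {p ! (j - 1), p ! j} \<in> edges \<Gamma>) \<and>
     (\<forall>j. 1 \<le> j \<and> j \<le> i - 1 \<longrightarrow> p ! (j - 1) \<noteq> p ! (j + 1))}"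

definition arcs_from :: "'a graph \<Rightarrow> nat \<Rightarrow> 'a \<Rightarrow> 'a list set" where
  "arcs_from \<Gamma> i v = {p \<in> arcs \<Gamma> i. hd p = v}"

text \<open>
  Transitivity of a set of group elements, acting entrywise, on a set of tuples
  (vacuously true if there are no tuples).
\<close>

definition transitive_on_tuples ::
    "'g set \<Rightarrow> ('g \<Rightarrow> 'a \<Rightarrow> 'a) \<Rightarrow> 'a list set \<Rightarrow> bool" where
  "transitive_on_tuples H \<phi> P \<longleftrightarrow> (\<forall>p\<in>P. \<forall>q\<in>P. \<exists>h\<in>H. map (\<phi> h) p = q)"

text \<open>
  In the next two definitions \<open>\<Gamma>\<close> is meant to be connected and \<open>\<phi>\<close> to be an action of \<open>G\<close>
  on \<open>\<Gamma>\<close> by automorphisms.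
\<close>

definition arc_transitive ::
    "('g, 'b) monoid_scheme \<Rightarrow> ('g \<Rightarrow> 'a \<Rightarrow> 'a) \<Rightarrow> 'a graph \<Rightarrow> nat \<Rightarrow> bool" where
  "arc_transitive G \<phi> \<Gamma> s \<longleftrightarrow>
     arcs \<Gamma> s \<noteq> {} \<and>
     (\<forall>i. 1 \<le> i \<and> i \<le> s \<longrightarrow> transitive_on_tuples (carrier G) \<phi> (arcs \<Gamma> i))"

definition locally_arc_transitive ::
    "('g, 'b) monoid_scheme \<Rightarrow> ('g \<Rightarrow> 'a \<Rightarrow> 'a) \<Rightarrow> 'a graph \<Rightarrow> nat \<Rightarrow> bool" where
  "locally_arc_transitive G \<phi> \<Gamma> s \<longleftrightarrow>
     (\<forall>v\<in>vertices \<Gamma>. \<forall>i. 1 \<le> i \<and> i \<le> s \<longrightarrow>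
        transitive_on_tuples (stabilizer G \<phi> v) \<phi> (arcs_from \<Gamma> i v)) \<and>
     (\<exists>v\<in>vertices \<Gamma>. arcs_from \<Gamma> s v \<noteq> {})"

lemma simple_graph_subdivision: "simple_graph (subdivision \<Gamma>)"
  by (fastforce simp: simple_graph_def subdivision_def)

lemma graph_Aut_subgroup: "subgroup (carrier (graph_Aut \<Gamma>)) (BijGroup (vertices \<Gamma>))"
proof -
  let ?V = "vertices \<Gamma>"
  interpret B: group "BijGroup ?V" by (rule group_BijGroup)
  show ?thesis
  proof (rule B.subgroupI)
    show "carrier (graph_Aut \<Gamma>) \<subseteq> carrier (BijGroup ?V)"
      by (auto simp: graph_Aut_def BijGroup_def)
    have "(\<lambda>x\<in>?V. x) \<in> carrier (graph_Aut \<Gamma>)"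
      by (auto simp: graph_Aut_def id_Bij)
    then show "carrier (graph_Aut \<Gamma>) \<noteq> {}" by blast
  next
    fix g assume g: "g \<in> carrier (graph_Aut \<Gamma>)"
    then have gB: "g \<in> Bij ?V" by (simp add: graph_Aut_def)
    have inv: "inv\<^bsub>BijGroup ?V\<^esub> g = restrict (inv_into ?V g) ?V"
      using inv_BijGroup[OF gB] by simp
    have iB: "restrict (inv_into ?V g) ?V \<in> Bij ?V" by (rule restrict_inv_into_Bij[OF gB])
    have im: "g ` ?V = ?V" using gB by (simp add: Bij_def bij_betw_def)
    have "{inv_into ?V g x, inv_into ?V g y} \<in> edges \<Gamma> \<longleftrightarrow> {x, y} \<in> edges \<Gamma>"
      if "x \<in> ?V" "y \<in> ?V" for x y
    proof -
      let ?x = "inv_into ?V g x" and ?y = "inv_into ?V g y"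
      have "?x \<in> ?V" "?y \<in> ?V"
        using that im by (simp_all add: inv_into_into)
      moreover have "g ?x = x" "g ?y = y"
        using that im by (simp_all add: f_inv_into_f)
      moreover have "{g u, g v} \<in> edges \<Gamma> \<longleftrightarrow> {u, v} \<in> edges \<Gamma>" if "u \<in> ?V" "v \<in> ?V" for u v
        using g that by (simp add: graph_Aut_def)
      from this[of ?x ?y] calculation show ?thesis by simp
    qed
    then show "inv\<^bsub>BijGroup ?V\<^esub> g \<in> carrier (graph_Aut \<Gamma>)"
      using iB unfolding inv by (simp add: graph_Aut_def)
  next
    fix g h assume g: "g \<in> carrier (graph_Aut \<Gamma>)" and h: "h \<in> carrier (graph_Aut \<Gamma>)"
    then have gB: "g \<in> Bij ?V" and hB: "h \<in> Bij ?V" by (simp_all add: graph_Aut_def)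
    have "h x \<in> ?V" if "x \<in> ?V" for x
      using hB that by (auto simp: Bij_def bij_betw_def)
    then show "g \<otimes>\<^bsub>BijGroup ?V\<^esub> h \<in> carrier (graph_Aut \<Gamma>)"
      using g h gB hB compose_Bij[OF gB hB]
      by (simp add: graph_Aut_def BijGroup_def compose_def)
  qed
qed

lemma group_graph_Aut: "group (graph_Aut \<Gamma>)"
proof -
  interpret B: group "BijGroup (vertices \<Gamma>)" by (rule group_BijGroup)
  have "graph_Aut \<Gamma> = BijGroup (vertices \<Gamma>)\<lparr>carrier := carrier (graph_Aut \<Gamma>)\<rparr>"
    by (simp add: graph_Aut_def)
  with B.subgroup_imp_group[OF graph_Aut_subgroup[of \<Gamma>]] show ?thesis by simp
qed

lemma graph_Aut_closed:
  assumes "g \<in> carrier (graph_Aut \<Gamma>)" "x \<in> vertices \<Gamma>"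
  shows "g x \<in> vertices \<Gamma>"
  using assms by (auto simp: graph_Aut_def Bij_def bij_betw_def)

lemma graph_Aut_inj: "g \<in> carrier (graph_Aut \<Gamma>) \<Longrightarrow> inj_on g (vertices \<Gamma>)"
  by (auto simp: graph_Aut_def Bij_def bij_betw_def)

lemma graph_Aut_surj: "g \<in> carrier (graph_Aut \<Gamma>) \<Longrightarrow> g ` vertices \<Gamma> = vertices \<Gamma>"
  by (auto simp: graph_Aut_def Bij_def bij_betw_def)

lemma graph_Aut_edge:
  assumes "g \<in> carrier (graph_Aut \<Gamma>)" "e \<subseteq> vertices \<Gamma>" "simple_graph \<Gamma>" "e \<in> edges \<Gamma>"
  shows "g ` e \<in> edges \<Gamma>"
proof -
  obtain x y where "x \<in> vertices \<Gamma>" "y \<in> vertices \<Gamma>" "e = {x, y}"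
    using assms unfolding simple_graph_def by blast
  then show ?thesis using assms by (auto simp: graph_Aut_def)
qed

lemma simple_graph_edge_subset: "simple_graph \<Gamma> \<Longrightarrow> e \<in> edges \<Gamma> \<Longrightarrow> e \<subseteq> vertices \<Gamma>"
  by (fastforce simp: simple_graph_def)

lemma subdivision_action_in_Aut:
  assumes S: "simple_graph \<Gamma>" and g: "g \<in> carrier (graph_Aut \<Gamma>)"
  shows "subdivision_action \<Gamma> g \<in> carrier (graph_Aut (subdivision \<Gamma>))"
proof -
  let ?V = "vertices \<Gamma>" and ?E = "edges \<Gamma>" and ?W = "vertices (subdivision \<Gamma>)"
  let ?f = "subdivision_action \<Gamma> g"
  note sub = simple_graph_edge_subset[OF S]
  note inj = graph_Aut_inj[OF g]
  have W: "?W = ?V <+> ?E" by (simp add: subdivision_def)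
  have f: "\<And>x. x \<in> ?V \<Longrightarrow> ?f (Inl x) = Inl (g x)" "\<And>e. e \<in> ?E \<Longrightarrow> ?f (Inr e) = Inr (g ` e)"
    by (auto simp: subdivision_action_def W)
  have edge_surj: "\<exists>e'\<in>?E. g ` e' = e" if e: "e \<in> ?E" for e
  proof -
    obtain x y where xy: "x \<in> ?V" "y \<in> ?V" "e = {x, y}"
      using S e unfolding simple_graph_def by blast
    then obtain x' y' where "x' \<in> ?V" "y' \<in> ?V" "x = g x'" "y = g y'"
      using graph_Aut_surj[OF g] by (metis imageE)
    then have "{x', y'} \<in> ?E" using g e xy by (auto simp: graph_Aut_def)
    then show ?thesis using xy \<open>x = g x'\<close> \<open>y = g y'\<close> by (intro bexI[of _ "{x', y'}"]) auto
  qed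
  have "inj_on ?f ?W"
  proof (rule inj_onI)
    fix a b assume ab: "a \<in> ?W" "b \<in> ?W" "?f a = ?f b"
    have "d = e" if "d \<in> ?E" "e \<in> ?E" "g ` d = g ` e" for d e
      using that inj_on_image_eq_iff[OF inj sub sub] by blast
    moreover have "x = y" if "x \<in> ?V" "y \<in> ?V" "g x = g y" for x y
      using that inj by (blast dest: inj_onD)
    ultimately show "a = b" using ab f unfolding W by (auto del: equalityI subsetI)
  qed
  moreover have "?f ` ?W = ?W"
  proof
    show "?f ` ?W \<subseteq> ?W"
      using f graph_Aut_closed[OF g] graph_Aut_edge[OF g sub S] unfolding W by auto
    show "?W \<subseteq> ?f ` ?W"
    proof
      fix w assume "w \<in> ?W"
      then consider x where "x \<in> ?V" "w = Inl x" | e where "e \<in> ?E" "w = Inr e"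
        unfolding W by auto
      then show "w \<in> ?f ` ?W"
      proof cases
        case 1
        then obtain x' where "x' \<in> ?V" "g x' = x" using graph_Aut_surj[OF g] by (metis imageE)
        then show ?thesis using 1 f(1)[of x'] unfolding W by (metis InlI imageI)
      next
        case 2
        then obtain e' where "e' \<in> ?E" "g ` e' = e" using edge_surj by blast
        then show ?thesis using 2 f(2)[of e'] unfolding W by (metis InrI imageI)
      qed
    qed
  qed
  ultimately have "?f \<in> Bij ?W"
    by (simp add: Bij_def bij_betw_def subdivision_action_def)
  moreover have "{?f a, ?f b} \<in> edges (subdivision \<Gamma>) \<longleftrightarrow> {a, b} \<in> edges (subdivision \<Gamma>)"
    if ab: "a \<in> ?W" "b \<in> ?W" for a b
  proof -
    have mem: "g x \<in> g ` e \<longleftrightarrow> x \<in> e" if "x \<in> ?V" "e \<in> ?E" for x e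
      using inj sub that by (simp add: inj_on_image_mem_iff)
    have adj: "{Inl x, Inr e} \<in> edges (subdivision \<Gamma>) \<longleftrightarrow> x \<in> ?V \<and> e \<in> ?E \<and> x \<in> e"
      "{Inr e, Inl x} \<in> edges (subdivision \<Gamma>) \<longleftrightarrow> x \<in> ?V \<and> e \<in> ?E \<and> x \<in> e"
      "{Inl x, Inl y} \<notin> edges (subdivision \<Gamma>)"
      "{Inr d, Inr e} \<notin> edges (subdivision \<Gamma>)" for x y d e
      by (auto simp: subdivision_def doubleton_eq_iff)
    have gV: "g x \<in> ?V" if "x \<in> ?V" for x
      using graph_Aut_closed[OF g that] .
    have gE: "g ` e \<in> ?E" if "e \<in> ?E" for e
      using graph_Aut_edge[OF g sub S] that by blast
    show ?thesis
    proof -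
      consider x y where "a = Inl x" "b = Inl y" "x \<in> ?V" "y \<in> ?V"
        | x e where "a = Inl x" "b = Inr e" "x \<in> ?V" "e \<in> ?E"
        | e x where "a = Inr e" "b = Inl x" "e \<in> ?E" "x \<in> ?V"
        | d e where "a = Inr d" "b = Inr e" "d \<in> ?E" "e \<in> ?E"
        using ab unfolding W by blast
      then show ?thesis
        by cases (simp_all add: f adj mem gV gE)
    qed
  qed
  ultimately show ?thesis by (simp add: graph_Aut_def)
qed

lemma subdivision_action_hom:
  assumes S: "simple_graph \<Gamma>" and G: "subgroup G (graph_Aut \<Gamma>)"
  shows "subdivision_action \<Gamma>
    \<in> hom (graph_Aut \<Gamma>\<lparr>carrier := G\<rparr>) (graph_Aut (subdivision \<Gamma>))"
proof (rule homI)
  note GA = subgroup.subset[OF G]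
  fix g assume "g \<in> carrier (graph_Aut \<Gamma>\<lparr>carrier := G\<rparr>)"
  then show "subdivision_action \<Gamma> g \<in> carrier (graph_Aut (subdivision \<Gamma>))"
    using subdivision_action_in_Aut[OF S] GA by auto
next
  note GA = subgroup.subset[OF G]
  let ?A = "graph_Aut \<Gamma>\<lparr>carrier := G\<rparr>" and ?W = "vertices (subdivision \<Gamma>)"
  fix g h assume "g \<in> carrier ?A" "h \<in> carrier ?A"
  then have g: "g \<in> carrier (graph_Aut \<Gamma>)" and h: "h \<in> carrier (graph_Aut \<Gamma>)"
    using GA by auto
  then have "g \<in> Bij (vertices \<Gamma>)" "h \<in> Bij (vertices \<Gamma>)" by (simp_all add: graph_Aut_def)
  then have gh: "g \<otimes>\<^bsub>?A\<^esub> h = compose (vertices \<Gamma>) g h"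
    by (simp add: graph_Aut_def BijGroup_def)
  have "subdivision_action \<Gamma> g \<in> Bij ?W" "subdivision_action \<Gamma> h \<in> Bij ?W"
    using subdivision_action_in_Aut[OF S g] subdivision_action_in_Aut[OF S h]
    by (simp_all add: graph_Aut_def)
  then have m: "subdivision_action \<Gamma> g \<otimes>\<^bsub>graph_Aut (subdivision \<Gamma>)\<^esub> subdivision_action \<Gamma> h
      = compose ?W (subdivision_action \<Gamma> g) (subdivision_action \<Gamma> h)"
    by (simp add: graph_Aut_def BijGroup_def)
  have "subdivision_action \<Gamma> (compose (vertices \<Gamma>) g h) w
      = compose ?W (subdivision_action \<Gamma> g) (subdivision_action \<Gamma> h) w" for w
  proof (cases "w \<in> ?W")
    case False
    then show ?thesis by (simp add: subdivision_action_def compose_def)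
  next
    case True
    then consider x where "x \<in> vertices \<Gamma>" "w = Inl x" | e where "e \<in> edges \<Gamma>" "w = Inr e"
      by (auto simp: subdivision_def)
    then show ?thesis
    proof cases
      case 1
      then show ?thesis
        using graph_Aut_closed[OF h]
        by (simp add: subdivision_action_def compose_def subdivision_def InlI)
    next
      case 2
      have "e \<subseteq> vertices \<Gamma>" using simple_graph_edge_subset[OF S] 2 by blast
      moreover have "h ` e \<in> edges \<Gamma>"
        using graph_Aut_edge[OF h] calculation S 2 by blast
      moreover have "compose (vertices \<Gamma>) g h ` e = g ` h ` e"
        using calculation by (force simp: compose_def)
      ultimately show ?thesis
        using 2 True by (simp add: subdivision_action_def compose_def subdivision_def InrI)
    qed
  qed
  then show "subdivision_action \<Gamma> (g \<otimes>\<^bsub>?A\<^esub> h) = subdivision_action \<Gamma> g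
      \<otimes>\<^bsub>graph_Aut (subdivision \<Gamma>)\<^esub> subdivision_action \<Gamma> h"
    unfolding gh m by blast
qed

text \<open>
  The complete graph \<open>K\<^sub>2\<close> with \<open>s = 2\<close> is exceptional: its subdivision is a path with
  three vertices, which contains 2-arcs and is locally 2-arc transitive, while \<open>K\<^sub>2\<close> has no
  2-arc and \<open>\<lceil>(2 + 1) / 2\<rceil> = 2\<close>.
\<close>

lemma K2_exceptional:
  assumes ab: "a \<noteq> b" and \<Gamma>: "\<Gamma> = \<lparr>vertices = {a, b}, edges = {{a, b}}\<rparr>"
  shows "locally_arc_transitive (graph_Aut \<Gamma>) (subdivision_action \<Gamma>) (subdivision \<Gamma>) 2"
    and "\<not> arc_transitive (graph_Aut \<Gamma>) (\<lambda>g. g) \<Gamma> (nat \<lceil>(real 2 + 1) / 2\<rceil>)"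
proof -
  let ?S = "subdivision \<Gamma>" and ?m = "Inr {a, b} :: 'a + 'a set"
  let ?f = "subdivision_action \<Gamma>"
  define i where "i = (\<lambda>x\<in>{a, b}. x)"
  define t where "t = (\<lambda>x\<in>{a, b}. if x = a then b else a)"
  have VS: "vertices ?S = {Inl a, Inl b, ?m}"
    by (auto simp: subdivision_def \<Gamma>)
  have ES: "edges ?S = {{Inl a, ?m}, {Inl b, ?m}}"
    by (auto simp: subdivision_def \<Gamma>)
  have i: "i \<in> carrier (graph_Aut \<Gamma>)"
    by (auto simp: graph_Aut_def \<Gamma> i_def id_Bij)
  have "t \<in> Bij {a, b}"
    using ab by (auto simp: Bij_def bij_betw_def t_def inj_on_def)
  then have t: "t \<in> carrier (graph_Aut \<Gamma>)"
    using ab by (auto simp: graph_Aut_def \<Gamma> t_def doubleton_eq_iff)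
  have fi: "?f i w = w" if "w \<in> vertices ?S" for w
    using that ab by (auto simp: VS subdivision_action_def i_def)
  have ft: "?f t (Inl a) = Inl b" "?f t (Inl b) = Inl a" "?f t ?m = ?m"
    using ab by (auto simp: VS subdivision_action_def t_def)
  have arc1: "p \<in> {[Inl a, ?m], [Inl b, ?m], [?m, Inl a], [?m, Inl b]}"
    if "p \<in> arcs ?S 1" for p
  proof -
    obtain u w where "p = [u, w]" "{u, w} \<in> edges ?S"
      using \<open>p \<in> arcs ?S 1\<close> by (auto simp: arcs_def length_Suc_conv numeral_2_eq_2)
    then show ?thesis by (auto simp: ES doubleton_eq_iff)
  qed
  have arc2: "p \<in> {[Inl a, ?m, Inl b], [Inl b, ?m, Inl a]}" if "p \<in> arcs ?S 2" for p
  proof -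
    have "length p = Suc (Suc (Suc 0))" using that by (simp add: arcs_def)
    then obtain u w z where p: "p = [u, w, z]" by (auto simp: length_Suc_conv)
    have e: "\<forall>j. 1 \<le> j \<and> j \<le> 2 \<longrightarrow> {p ! (j - 1), p ! j} \<in> edges ?S"
      and d: "\<forall>j. 1 \<le> j \<and> j \<le> 2 - 1 \<longrightarrow> p ! (j - 1) \<noteq> p ! (j + 1)"
      using that by (auto simp: arcs_def)
    have "{u, w} \<in> edges ?S" "{w, z} \<in> edges ?S" "u \<noteq> z"
      using e[rule_format, of 1] e[rule_format, of 2] d[rule_format, of 1] by (simp_all add: p)
    then show ?thesis by (auto simp: ES p doubleton_eq_iff)
  qed
  have "\<exists>h\<in>stabilizer (graph_Aut \<Gamma>) ?f v. map (?f h) p = q"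
    if v: "v \<in> vertices ?S" and k: "1 \<le> k" "k \<le> 2"
      and p: "p \<in> arcs_from ?S k v" and q: "q \<in> arcs_from ?S k v" for v k p q
  proof (cases "p = q")
    case True
    have "set p \<subseteq> vertices ?S" using p by (simp add: arcs_from_def arcs_def)
    then have "map (?f i) p = p" using fi by (simp add: map_idI subset_iff)
    then show ?thesis using True i fi[OF v] by (auto simp: stabilizer_def)
  next
    case False
    have "k = 1 \<or> k = 2" using k by linarith
    then have "v = ?m \<and> (p = [?m, Inl a] \<and> q = [?m, Inl b] \<or> p = [?m, Inl b] \<and> q = [?m, Inl a])"
      using p q False arc1[of p] arc1[of q] arc2[of p] arc2[of q] ab
      by (auto simp: arcs_from_def)
    then show ?thesis using t ft by (auto simp: stabilizer_def intro!: bexI[of _ t])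
  qed
  moreover have "[Inl a, ?m, Inl b] \<in> arcs_from ?S 2 (Inl a)"
  proof -
    have "{[Inl a, ?m, Inl b] ! (j - 1), [Inl a, ?m, Inl b] ! j} \<in> edges ?S"
      if "1 \<le> j" "j \<le> 2" for j
    proof -
      have "j = 1 \<or> j = 2" using that by linarith
      then show ?thesis by (auto simp: ES insert_commute)
    qed
    moreover have "[Inl a, ?m, Inl b] ! (j - 1) \<noteq> [Inl a, ?m, Inl b] ! (j + 1)"
      if "1 \<le> j" "j \<le> 2 - 1" for j
    proof -
      have "j = 1" using that by linarith
      then show ?thesis using ab by simp
    qed
    ultimately show ?thesis by (simp add: arcs_from_def arcs_def VS)
  qed
  ultimately show "locally_arc_transitive (graph_Aut \<Gamma>) ?f ?S 2"
    unfolding locally_arc_transitive_def transitive_on_tuples_def VS by blast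
  have "arcs \<Gamma> 2 = {}"
  proof (rule equals0I)
    fix p assume p2: "p \<in> arcs \<Gamma> 2"
    then have "length p = Suc (Suc (Suc 0))" by (simp add: arcs_def)
    then obtain u w z where p: "p = [u, w, z]" by (auto simp: length_Suc_conv)
    have e: "\<forall>j. 1 \<le> j \<and> j \<le> 2 \<longrightarrow> {p ! (j - 1), p ! j} \<in> edges \<Gamma>"
      and d: "\<forall>j. 1 \<le> j \<and> j \<le> 2 - 1 \<longrightarrow> p ! (j - 1) \<noteq> p ! (j + 1)"
      using p2 by (auto simp: arcs_def)
    have "{u, w} \<in> edges \<Gamma>" "{w, z} \<in> edges \<Gamma>" "u \<noteq> z"
      using e[rule_format, of 1] e[rule_format, of 2] d[rule_format, of 1] by (simp_all add: p)
    then show False using ab by (auto simp: \<Gamma> doubleton_eq_iff)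
  qed
  moreover have "nat \<lceil>(real 2 + 1) / 2\<rceil> = 2"
  proof -
    have "\<lceil>(real 2 + 1) / 2\<rceil> = 2" by (rule ceiling_unique) auto
    then show ?thesis by simp
  qed
  ultimately show "\<not> arc_transitive (graph_Aut \<Gamma>) (\<lambda>g. g) \<Gamma> (nat \<lceil>(real 2 + 1) / 2\<rceil>)"
    by (simp only: arc_transitive_def simp_thms)
qed

end

theory Submission
  imports Defs
begin

text \<open>
  Inserting the edges between consecutive vertices turns a \<open>k\<close>-arc of \<open>\<Sigma>\<close> into a \<open>2k\<close>-arc of the
  subdivision graph that starts and ends at old vertices. Conversely, an arc of the subdivision
  graph alternates between vertices and edges, and completing it by a missing end of its first or
  last edge gives such a subdivided arc. Hence the \<open>i\<close>-arcs of the subdivision graph are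
  essentially arcs of \<open>\<Sigma>\<close>: those that start at a vertex \<open>x\<close> correspond to the \<open>\<lceil>i/2\<rceil>\<close>-arcs from \<open>x\<close>
  (\<open>arc_from_vertex\<close>), and, for \<open>i \<ge> 1\<close>, those that start at an edge \<open>e\<close> correspond to the
  \<open>(\<lfloor>i/2\<rfloor> + 1)\<close>-arcs whose first edge is \<open>e\<close> (\<open>arc_from_edge\<close>). The correspondence commutes with
  automorphisms. The longest arcs of \<open>\<Sigma>\<close> that occur for \<open>i \<le> s\<close> have length
  \<open>\<lfloor>s/2\<rfloor> + 1 = \<lceil>(s + 1)/2\<rceil>\<close>, which is where the number in the theorem comes from.

  If \<open>\<Sigma>\<close> is arc transitive up to this length, two \<open>i\<close>-arcs of the subdivision graph with the same
  start come from arcs of \<open>\<Sigma>\<close> of one length; a group element that maps one to the other also maps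
  one \<open>i\<close>-arc to the other, so it fixes the common start.

  Conversely, local transitivity on 1-arcs at an edge lets the stabiliser of that edge swap its
  ends, so by connectivity \<open>G\<close> is transitive on vertices, and local transitivity on 1-arcs at a
  vertex then makes \<open>G\<close> transitive on the 1-arcs of \<open>\<Sigma>\<close>. To map one \<open>k\<close>-arc to another one may
  therefore assume that they have the same first edge \<open>e\<close>, and the stabiliser of \<open>e\<close> does the rest:
  for \<open>k \<ge> 2\<close> the arc of the subdivision graph from \<open>e\<close> to the last edge has length \<open>2k - 2 \<le> s\<close>
  and still determines the \<open>k\<close>-arc (\<open>butlast_tl_subdivide_inject\<close>).

  What remains is the existence of an arc of length \<open>\<lfloor>s/2\<rfloor> + 1\<close>. An \<open>s\<close>-arc of the subdivision
  graph gives one directly unless \<open>s = 2k\<close> and it starts at a vertex, when it gives only a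
  \<open>k\<close>-arc. That arc can be prolonged, because otherwise an end of it has valency one, hence every
  vertex has, and \<open>\<Sigma>\<close> is the complete graph on two vertices with \<open>k = 1\<close>: this is the excluded case.
\<close>

section \<open>Arcs as lists\<close>

lemma arcs_length: "p \<in> arcs \<Gamma> i \<Longrightarrow> length p = Suc i"
  by (simp add: arcs_def)

lemma arcs_vertices: "p \<in> arcs \<Gamma> i \<Longrightarrow> set p \<subseteq> vertices \<Gamma>"
  by (simp add: arcs_def)

lemma arcs_0: "[x] \<in> arcs \<Gamma> 0 \<longleftrightarrow> x \<in> vertices \<Gamma>"
  by (simp add: arcs_def)

text \<open>
  Lists carry the arcs recursively: this rule replaces the index conditions in the definition of
  arcs in all that follows.
\<close>

lemma arcs_Cons:
  "x # y # r \<in> arcs \<Gamma> (Suc i) \<longleftrightarrow>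
     x \<in> vertices \<Gamma> \<and> {x, y} \<in> edges \<Gamma> \<and> y # r \<in> arcs \<Gamma> i \<and> (r = [] \<or> hd r \<noteq> x)"
proof -
  \<comment> \<open>Splits off the index at which the new first vertex enters the two index conditions.\<close>
  have shift: "(\<forall>j. 1 \<le> j \<and> j \<le> Suc n \<longrightarrow> P j) \<longleftrightarrow> P 1 \<and> (\<forall>j. 1 \<le> j \<and> j \<le> n \<longrightarrow> P (Suc j))"
    for P and n :: nat
  proof (intro iffI conjI allI impI)
    fix j assume P: "P 1 \<and> (\<forall>j. 1 \<le> j \<and> j \<le> n \<longrightarrow> P (Suc j))" "1 \<le> j \<and> j \<le> Suc n"
    then show "P j" by (cases j; cases "j = 1") auto
  qed auto
  show ?thesis
  proof (cases "length r = i")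
    case False
    then show ?thesis by (auto simp: arcs_def)
  next
    case len: True
    let ?p = "x # y # r"
    have E: "(\<forall>j. 1 \<le> j \<and> j \<le> Suc i \<longrightarrow> {?p ! (j - 1), ?p ! j} \<in> edges \<Gamma>) \<longleftrightarrow>
        {x, y} \<in> edges \<Gamma> \<and> (\<forall>j. 1 \<le> j \<and> j \<le> i \<longrightarrow> {(y # r) ! (j - 1), (y # r) ! j} \<in> edges \<Gamma>)"
      unfolding shift by (auto simp: nth_Cons')
    have D: "(\<forall>j. 1 \<le> j \<and> j \<le> Suc i - 1 \<longrightarrow> ?p ! (j - 1) \<noteq> ?p ! (j + 1)) \<longleftrightarrow>
        (r = [] \<or> hd r \<noteq> x) \<and>
        (\<forall>j. 1 \<le> j \<and> j \<le> i - 1 \<longrightarrow> (y # r) ! (j - 1) \<noteq> (y # r) ! (j + 1))"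
    proof (cases i)
      case 0
      then show ?thesis using len by simp
    next
      case (Suc n)
      then obtain z t where "r = z # t" using len by (cases r) auto
      then show ?thesis unfolding Suc diff_Suc_1 shift by (auto simp: nth_Cons')
    qed
    show ?thesis using len unfolding arcs_def mem_Collect_eq E D by auto
  qed
qed

lemma arcs_Suc_cases:
  assumes "p \<in> arcs \<Gamma> (Suc i)"
  obtains x y r where "p = x # y # r" "x \<in> vertices \<Gamma>" "{x, y} \<in> edges \<Gamma>" "y # r \<in> arcs \<Gamma> i"
    "r = [] \<or> hd r \<noteq> x"
proof -
  obtain x y r where "p = x # y # r"
    using arcs_length[OF assms] by (metis length_Suc_conv)
  then show thesis using that assms arcs_Cons by metis
qed

lemma arcs_0_cases:
  assumes "p \<in> arcs \<Gamma> 0"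
  obtains x where "p = [x]" "x \<in> vertices \<Gamma>"
  using assms arcs_0 by (metis arcs_length length_0_conv length_Suc_conv)

lemma arcs_take: "p \<in> arcs \<Gamma> i \<Longrightarrow> j \<le> i \<Longrightarrow> take (Suc j) p \<in> arcs \<Gamma> j"
  by (auto simp: arcs_def dest: in_set_takeD)

lemma arcs_map:
  assumes "g \<in> carrier (graph_Aut \<Gamma>)" and "p \<in> arcs \<Gamma> i"
  shows "map g p \<in> arcs \<Gamma> i"
  using assms(2)
proof (induction i arbitrary: p)
  case 0
  then show ?case using graph_Aut_closed[OF assms(1)] by (auto elim!: arcs_0_cases simp: arcs_0)
next
  case (Suc i)
  from Suc.prems obtain x y r where p: "p = x # y # r" "x \<in> vertices \<Gamma>" "{x, y} \<in> edges \<Gamma>"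
    "y # r \<in> arcs \<Gamma> i" "r = [] \<or> hd r \<noteq> x" by (rule arcs_Suc_cases)
  have yr: "y \<in> vertices \<Gamma>" "set r \<subseteq> vertices \<Gamma>" using arcs_vertices[OF p(4)] by auto
  have "{g x, g y} \<in> edges \<Gamma>" using assms(1) p yr by (simp add: graph_Aut_def)
  moreover have "r = [] \<or> hd (map g r) \<noteq> g x"
    using p yr graph_Aut_inj[OF assms(1)] by (cases r) (auto dest: inj_onD)
  ultimately show ?case
    using p Suc.IH[OF p(4)] graph_Aut_closed[OF assms(1)] by (simp add: arcs_Cons)
qed

section \<open>Arcs of the subdivision\<close>

fun subdivide :: "'a list \<Rightarrow> ('a + 'a set) list" where
  "subdivide [] = []"
| "subdivide [x] = [Inl x]"
| "subdivide (x # y # p) = Inl x # Inr {x, y} # subdivide (y # p)"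

lemma subdivide_Cons: "\<exists>t. subdivide (x # p) = Inl x # t"
  by (cases p) auto

lemma subdivision_simps:
  "Inl x \<in> vertices (subdivision \<Gamma>) \<longleftrightarrow> x \<in> vertices \<Gamma>"
  "Inr e \<in> vertices (subdivision \<Gamma>) \<longleftrightarrow> e \<in> edges \<Gamma>"
  "{Inl x, Inr e} \<in> edges (subdivision \<Gamma>) \<longleftrightarrow> x \<in> vertices \<Gamma> \<and> e \<in> edges \<Gamma> \<and> x \<in> e"
  "{Inr e, Inl x} \<in> edges (subdivision \<Gamma>) \<longleftrightarrow> x \<in> vertices \<Gamma> \<and> e \<in> edges \<Gamma> \<and> x \<in> e"
  "{Inl x, Inl y} \<notin> edges (subdivision \<Gamma>)"
  "{Inr d, Inr e} \<notin> edges (subdivision \<Gamma>)"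
  by (auto simp: subdivision_def doubleton_eq_iff)

lemma simple_graph_edgeD:
  assumes "simple_graph \<Gamma>" "{x, y} \<in> edges \<Gamma>"
  shows "x \<in> vertices \<Gamma>" "y \<in> vertices \<Gamma>" "x \<noteq> y"
  using assms unfolding simple_graph_def by (fastforce simp: doubleton_eq_iff)+

lemma simple_graph_other_end:
  assumes "simple_graph \<Gamma>" "e \<in> edges \<Gamma>" "y \<in> e"
  obtains x where "e = {x, y}" "x \<in> vertices \<Gamma>" "x \<noteq> y"
proof -
  obtain a b where "a \<in> vertices \<Gamma>" "b \<in> vertices \<Gamma>" "a \<noteq> b" "e = {a, b}"
    using assms(1,2) unfolding simple_graph_def by blast
  then show thesis using that[of a] that[of b] assms(3) by (auto simp: insert_commute)
qed

lemma subdivide_arcs: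
  assumes "simple_graph \<Gamma>" and "p \<in> arcs \<Gamma> k"
  shows "subdivide p \<in> arcs (subdivision \<Gamma>) (2 * k)"
  using assms(2)
proof (induction k arbitrary: p)
  case 0
  then show ?case by (auto elim!: arcs_0_cases simp: arcs_0 subdivision_simps)
next
  case (Suc k)
  from Suc.prems obtain x y r where p: "p = x # y # r" "x \<in> vertices \<Gamma>" "{x, y} \<in> edges \<Gamma>"
    "y # r \<in> arcs \<Gamma> k" "r = [] \<or> hd r \<noteq> x" by (rule arcs_Suc_cases)
  obtain t where t: "subdivide (y # r) = Inl y # t" using subdivide_Cons by metis
  note xy = simple_graph_edgeD[OF assms(1) p(3)]
  have "t = [] \<or> hd t \<noteq> Inr {x, y}"
    using t p(5) xy by (cases r) (auto simp: doubleton_eq_iff)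
  then show ?case
    using Suc.IH[OF p(4)] p xy unfolding p(1) by (simp add: t arcs_Cons subdivision_simps)
qed

text \<open>
  The common step in reading off an arc of \<open>\<Gamma>\<close> from an arc of its subdivision: once the part from
  \<open>y\<close> on is known to be a piece of a subdivided arc \<open>p\<close>, a preceding edge \<open>{x, y}\<close> prolongs \<open>p\<close> by
  \<open>x\<close>. Distinct consecutive edges in the subdivision mean that \<open>x\<close> differs from the vertex after
  \<open>y\<close>. The length \<open>Suc i div 2\<close> is the least possible; for a longer \<open>p\<close> its second vertex would
  not be visible in \<open>r\<close> when \<open>i = 0\<close>, and could be \<open>x\<close>.
\<close>

lemma arcs_subdivide_Cons:
  assumes S: "simple_graph \<Gamma>" and q: "Inr {x, y} # Inl y # r \<in> arcs (subdivision \<Gamma>) (Suc i)"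
    and p: "p \<in> arcs \<Gamma> (Suc i div 2)" and r: "Inl y # r = take (Suc i) (subdivide p)"
  shows "x # p \<in> arcs \<Gamma> (Suc (Suc i div 2))"
    and "subdivide (x # p) = Inl x # Inr {x, y} # subdivide p"
proof -
  have e: "{x, y} \<in> edges \<Gamma>" and rx: "r = [] \<or> hd r \<noteq> Inr {x, y}"
    and yr: "Inl y # r \<in> arcs (subdivision \<Gamma>) i"
    using q by (auto simp: arcs_Cons subdivision_simps)
  have len: "length r = i" using arcs_length[OF yr] by simp
  obtain p' where p': "p = y # p'"
  proof (cases p)
    case (Cons a b)
    moreover obtain t where "subdivide (a # b) = Inl a # t" using subdivide_Cons by metis
    ultimately show thesis using that r by simp
  qed (use r in simp)
  show "subdivide (x # p) = Inl x # Inr {x, y} # subdivide p" by (simp add: p')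
  have "p' = [] \<or> hd p' \<noteq> x"
  proof (cases i)
    case 0
    then show ?thesis using arcs_length[OF p] p' by simp
  next
    case (Suc n)
    show ?thesis
    proof (cases p')
      case (Cons z u)
      then have "hd r = Inr {y, z}" "r \<noteq> []" using r Suc by (auto simp: p')
      then show ?thesis using rx Cons by (auto simp: insert_commute)
    qed simp
  qed
  then show "x # p \<in> arcs \<Gamma> (Suc (Suc i div 2))"
    using p e simple_graph_edgeD[OF S e] by (simp add: p' arcs_Cons)
qed

text \<open>
  By induction in steps of two: the arc begins with a vertex \<open>x\<close>, an edge \<open>{x, y}\<close> and then
  necessarily \<open>y\<close>, since it does not return to \<open>x\<close>. An arc that stops at the edge is completed
  by \<open>y\<close>; this is why the length is rounded up.
\<close>

lemma arc_from_vertex: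
  assumes S: "simple_graph \<Gamma>" and "Inl x # q \<in> arcs (subdivision \<Gamma>) i"
  shows "\<exists>p\<in>arcs \<Gamma> (Suc i div 2). Inl x # q = take (Suc i) (subdivide p)"
  using assms(2)
proof (induction i arbitrary: x q rule: less_induct)
  case (less i)
  have x: "x \<in> vertices \<Gamma>" using arcs_vertices[OF less.prems] by (simp add: subdivision_simps)
  show ?case
  proof (cases i)
    case 0
    then have "q = []" using arcs_length[OF less.prems] by simp
    then show ?thesis using x 0 by (intro bexI[of _ "[x]"]) (simp_all add: arcs_0)
  next
    case i: (Suc n)
    then obtain f t where q1: "q = f # t"
      using arcs_length[OF less.prems] by (cases q) auto
    then have q: "q = f # t" "{Inl x, f} \<in> edges (subdivision \<Gamma>)"
      "f # t \<in> arcs (subdivision \<Gamma>) n" "t = [] \<or> hd t \<noteq> Inl x"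
      using less.prems i by (simp_all add: arcs_Cons)
    from q(2) obtain e where f: "f = Inr e" and e: "e \<in> edges \<Gamma>" "x \<in> e"
      by (cases f) (auto simp: subdivision_simps)
    obtain y where y: "e = {y, x}" "y \<in> vertices \<Gamma>" "y \<noteq> x"
      using simple_graph_other_end[OF S e] .
    show ?thesis
    proof (cases n)
      case 0
      then have "q = [Inr {x, y}]" using arcs_length[OF q(3)] q(1) f y(1) by (auto simp: insert_commute)
      moreover have "[x, y] \<in> arcs \<Gamma> 1"
        using x y e by (simp add: arcs_0 arcs_Cons insert_commute)
      ultimately show ?thesis using i 0 by (intro bexI[of _ "[x, y]"]) simp_all
    next
      case n: (Suc m)
      then obtain z u where t1: "t = z # u"
        using arcs_length[OF q(3)] by (cases t) auto
      then have t: "t = z # u" "{f, z} \<in> edges (subdivision \<Gamma>)"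
        "z # u \<in> arcs (subdivision \<Gamma>) m"
        using q(3) n by (simp_all add: arcs_Cons)
      have "z \<noteq> Inl x" using q(4) t(1) by simp
      then have z: "z = Inl y" using t(2) f y(1) by (cases z) (auto simp: subdivision_simps)
      obtain p where p: "p \<in> arcs \<Gamma> (Suc m div 2)" "Inl y # u = take (Suc m) (subdivide p)"
        using less.IH[of m y u, OF _ t(3)[unfolded z]] i n by (metis lessI less_SucI)
      have q': "q = Inr {x, y} # Inl y # u" using q(1) t(1) z f y(1) by (simp add: insert_commute)
      then have "Inr {x, y} # Inl y # u \<in> arcs (subdivision \<Gamma>) (Suc m)"
        using q(1,3) n by simp
      note xp = arcs_subdivide_Cons[OF S this p]
      have "Inl x # q = take (Suc i) (subdivide (x # p))"
        unfolding xp(2) q' p(2) i n by simp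
      then show ?thesis using xp(1) i n by auto
    qed
  qed
qed

text \<open>
  The other end \<open>x\<close> of the initial edge is put in front; the tail operation removes it again from
  the subdivided arc.
\<close>

lemma arc_from_edge:
  assumes S: "simple_graph \<Gamma>" and q: "Inr e # q \<in> arcs (subdivision \<Gamma>) i" and "i \<ge> 1"
  shows "\<exists>p\<in>arcs \<Gamma> (Suc (i div 2)). Inr e # q = take (Suc i) (tl (subdivide p))"
proof -
  obtain m where i: "i = Suc m" using \<open>i \<ge> 1\<close> by (cases i) auto
  then obtain z u where "q = z # u"
    using arcs_length[OF q] by (cases q) auto
  then have t: "q = z # u" "{Inr e, z} \<in> edges (subdivision \<Gamma>)"
    "z # u \<in> arcs (subdivision \<Gamma>) m"
    using q i by (simp_all add: arcs_Cons)
  then obtain y where z: "z = Inl y" and e: "e \<in> edges \<Gamma>" "y \<in> e"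
    by (cases z) (auto simp: subdivision_simps)
  obtain x where x: "e = {x, y}" using simple_graph_other_end[OF S e] .
  obtain p where p: "p \<in> arcs \<Gamma> (Suc m div 2)" "Inl y # u = take (Suc m) (subdivide p)"
    using arc_from_vertex[OF S] t z by blast
  have "Inr {x, y} # Inl y # u \<in> arcs (subdivision \<Gamma>) (Suc m)"
    using q i t(1) z x by simp
  note xp = arcs_subdivide_Cons[OF S this p]
  have "Inr e # q = take (Suc i) (tl (subdivide (x # p)))"
    unfolding xp(2) t(1) z p(2) i x by simp
  then show ?thesis using xp(1) i by auto
qed

lemma subdivide_map:
  assumes "p \<in> arcs \<Gamma> k"
  shows "map (subdivision_action \<Gamma> g) (subdivide p) = subdivide (map g p)"
  using assms
proof (induction k arbitrary: p)
  case 0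
  then show ?case by (auto elim!: arcs_0_cases simp: subdivision_action_def subdivision_simps)
next
  case (Suc k)
  from Suc.prems obtain x y r where p: "p = x # y # r" "x \<in> vertices \<Gamma>" "{x, y} \<in> edges \<Gamma>"
    "y # r \<in> arcs \<Gamma> k" using arcs_Suc_cases by metis
  then show ?case using Suc.IH[OF p(4)] by (simp add: subdivision_action_def subdivision_simps)
qed

text \<open>
  The last vertex of an arc is the end of the last edge other than the vertex before it, so it can
  be dropped from the subdivided arc without loss; the second lemma does the same at both ends.
\<close>

lemma butlast_subdivide_inject:
  assumes "length p = length p'" "length p \<ge> 2" "butlast (subdivide p) = butlast (subdivide p')"
  shows "p = p'"
  using assms
proof (induction p arbitrary: p' rule: subdivide.induct)
  case (3 x y r)
  obtain x' y' r' where p': "p' = x' # y' # r'"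
    using "3.prems"(1) by (metis length_Suc_conv list.size(4) add.commute plus_1_eq_Suc)
  obtain t t' where t: "subdivide (y # r) = Inl y # t" "subdivide (y' # r') = Inl y' # t'"
    using subdivide_Cons by metis
  have "x = x'" "{x, y} = {x', y'}" and b: "butlast (subdivide (y # r)) = butlast (subdivide (y' # r'))"
    using "3.prems"(3) t by (auto simp: p')
  then have xy: "x = x'" "y = y'" by (auto simp: doubleton_eq_iff)
  show ?case
  proof (cases r)
    case Nil
    then show ?thesis using xy "3.prems"(1) p' by simp
  next
    case (Cons z u)
    then show ?thesis using "3.IH"[OF _ _ b] xy "3.prems"(1) p' by simp
  qed
qed auto

lemma butlast_tl_subdivide_inject:
  assumes len: "length p = length p'" "length p \<ge> 3"
    and eq: "butlast (tl (subdivide p)) = butlast (tl (subdivide p'))"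
  shows "p = p'"
proof -
  obtain x y z r where p: "p = x # y # z # r"
    using len(2) by (auto simp: Suc_le_length_iff numeral_3_eq_3)
  obtain x' y' z' r' where p': "p' = x' # y' # z' # r'"
    using len by (auto simp: Suc_le_length_iff numeral_3_eq_3)
  have e: "{x, y} = {x', y'}"
    and b: "butlast (subdivide (y # z # r)) = butlast (subdivide (y' # z' # r'))"
    using eq subdivide_Cons[of z r] subdivide_Cons[of z' r'] by (auto simp: p p')
  have "y # z # r = y' # z' # r'"
    by (rule butlast_subdivide_inject[OF _ _ b]) (use len p p' in auto)
  then show ?thesis using e by (auto simp: p p' doubleton_eq_iff)
qed

section \<open>Transitivity\<close>

lemma subgroup_graph_Aut_compose:
  assumes "subgroup G (graph_Aut \<Gamma>)" "g \<in> G" "h \<in> G"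
  obtains k where "k \<in> G" "\<And>x. x \<in> vertices \<Gamma> \<Longrightarrow> k x = h (g x)"
proof
  have "g \<in> Bij (vertices \<Gamma>)" "h \<in> Bij (vertices \<Gamma>)"
    using assms subgroup.subset by (fastforce simp: graph_Aut_def)+
  then have "h \<otimes>\<^bsub>graph_Aut \<Gamma>\<^esub> g = compose (vertices \<Gamma>) h g"
    by (simp add: graph_Aut_def BijGroup_def)
  then show "compose (vertices \<Gamma>) h g \<in> G"
    using subgroup.m_closed[OF assms(1,3,2)] by simp
qed (simp add: compose_def)

text \<open>
  Vertices and edges as starting points are treated alike: in both cases all \<open>i\<close>-arcs of the
  subdivision from \<open>v\<close> are the same segment (\<open>d = 0\<close> or \<open>d = 1\<close>) of subdivided arcs of \<open>\<Gamma>\<close> of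
  one length \<open>k\<close>.
\<close>

lemma arc_transitive_imp_locally:
  assumes S: "simple_graph \<Gamma>" and G: "subgroup G (graph_Aut \<Gamma>)" and s: "s \<ge> 1"
    and at: "arc_transitive (graph_Aut \<Gamma>\<lparr>carrier := G\<rparr>) (\<lambda>g. g) \<Gamma> (s div 2 + 1)"
  shows "locally_arc_transitive (graph_Aut \<Gamma>\<lparr>carrier := G\<rparr>) (subdivision_action \<Gamma>)
    (subdivision \<Gamma>) s"
proof -
  let ?f = "subdivision_action \<Gamma>" and ?S = "subdivision \<Gamma>"
  have "\<exists>h\<in>stabilizer (graph_Aut \<Gamma>\<lparr>carrier := G\<rparr>) ?f v. map (?f h) q = q'"
    if i: "1 \<le> i" "i \<le> s" and q: "q \<in> arcs_from ?S i v" "q' \<in> arcs_from ?S i v" for v i q q'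
  proof -
    have "\<exists>k d. 1 \<le> k \<and> k \<le> s div 2 + 1 \<and>
       (\<forall>q\<in>arcs_from ?S i v. \<exists>p\<in>arcs \<Gamma> k. q = take (Suc i) (drop d (subdivide p)))"
    proof (cases v)
      case (Inl x)
      have "\<exists>p\<in>arcs \<Gamma> (Suc i div 2). q = take (Suc i) (drop 0 (subdivide p))"
        if "q \<in> arcs_from ?S i v" for q
        using that arc_from_vertex[OF S, of x "tl q" i] arcs_length[of q ?S i] Inl
        by (cases q) (auto simp: arcs_from_def)
      moreover have "1 \<le> Suc i div 2" "Suc i div 2 \<le> s div 2 + 1" using i by auto
      ultimately show ?thesis by blast
    next
      case (Inr e)
      have "\<exists>p\<in>arcs \<Gamma> (Suc (i div 2)). q = take (Suc i) (drop 1 (subdivide p))"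
        if "q \<in> arcs_from ?S i v" for q
        using that arc_from_edge[OF S, of e "tl q" i] arcs_length[of q ?S i] Inr i
        by (cases q) (auto simp: arcs_from_def drop_Suc)
      moreover have "1 \<le> Suc (i div 2)" "Suc (i div 2) \<le> s div 2 + 1" using i
        by (auto intro: div_le_mono)
      ultimately show ?thesis by blast
    qed
    then obtain k d p p' where k: "1 \<le> k" "k \<le> s div 2 + 1" and p: "p \<in> arcs \<Gamma> k" "p' \<in> arcs \<Gamma> k"
      and qp: "q = take (Suc i) (drop d (subdivide p))" "q' = take (Suc i) (drop d (subdivide p'))"
      using q by meson
    have "transitive_on_tuples G (\<lambda>g. g) (arcs \<Gamma> k)"
      using at k by (simp add: arc_transitive_def)
    with p obtain g where g: "g \<in> G" "map g p = p'"
      unfolding transitive_on_tuples_def by blast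
    have m: "map (?f g) q = q'"
      using subdivide_map[OF p(1), of g] g qp by (metis drop_map take_map)
    have "q \<noteq> []" "hd q = v" "hd q' = v"
      using q arcs_length[of q ?S i] by (auto simp: arcs_from_def)
    \<comment> \<open>The two arcs share their first entry, so mapping one to the other fixes it.\<close>
    then have "?f g v = v" using m by (metis hd_map)
    then show ?thesis using g m by (auto simp: stabilizer_def)
  qed
  moreover have "\<exists>v\<in>vertices ?S. arcs_from ?S s v \<noteq> {}"
  proof -
    obtain p where p: "p \<in> arcs \<Gamma> (Suc (s div 2))" using at by (auto simp: arc_transitive_def)
    have "s \<le> 2 * Suc (s div 2)" by presburger
    from arcs_take[OF subdivide_arcs[OF S p] this] obtain q where q: "q \<in> arcs ?S s" by blast
    then have "hd q \<in> vertices ?S" using arcs_length[OF q] arcs_vertices[OF q] by (cases q) auto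
    then show ?thesis using q by (auto simp: arcs_from_def)
  qed
  ultimately show ?thesis by (auto simp: locally_arc_transitive_def transitive_on_tuples_def)
qed

lemma two_vertices_if_valency_one:
  assumes "connected_graph \<Gamma>" "simple_graph \<Gamma>" "{x, y} \<in> edges \<Gamma>"
    and one: "\<And>v a b. {v, a} \<in> edges \<Gamma> \<Longrightarrow> {v, b} \<in> edges \<Gamma> \<Longrightarrow> a = b"
  shows "vertices \<Gamma> = {x, y}"
proof
  note xy = simple_graph_edgeD[OF assms(2,3)]
  show "{x, y} \<subseteq> vertices \<Gamma>" using xy by simp
  have yx: "{y, x} \<in> edges \<Gamma>" using assms(3) by (simp add: insert_commute)
  show "vertices \<Gamma> \<subseteq> {x, y}"
  proof
    fix z assume "z \<in> vertices \<Gamma>"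
    then have "(x, z) \<in> {(x, y). {x, y} \<in> edges \<Gamma>}\<^sup>*"
      using assms(1) xy unfolding connected_graph_def by blast
    then show "z \<in> {x, y}"
      by (induction rule: rtrancl_induct) (use one assms(3) yx in blast)+
  qed
qed

text \<open>
  A \<open>k\<close>-arc that cannot be prolonged backwards starts at a vertex \<open>x\<close> of valency one. Vertex
  transitivity spreads this to all vertices, so \<open>\<Gamma>\<close> is a single edge. This has no 2-arc, hence
  \<open>k = 1\<close>, the case ruled out by the last hypothesis.
\<close>

lemma vertex_transitive_arc_extend:
  assumes con: "connected_graph \<Gamma>" and S: "simple_graph \<Gamma>" and G: "G \<subseteq> carrier (graph_Aut \<Gamma>)"
    and vt: "\<And>x y. x \<in> vertices \<Gamma> \<Longrightarrow> y \<in> vertices \<Gamma> \<Longrightarrow> \<exists>g\<in>G. g x = y"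
    and p: "p \<in> arcs \<Gamma> k" and k: "k \<ge> 1" and K2: "\<not> (card (vertices \<Gamma>) = 2 \<and> k = 1)"
  shows "arcs \<Gamma> (Suc k) \<noteq> {}"
proof
  assume none: "arcs \<Gamma> (Suc k) = {}"
  obtain n where kn: "k = Suc n" using k by (cases k) auto
  with p obtain x y r where p': "p = x # y # r" and x: "x \<in> vertices \<Gamma>" "{x, y} \<in> edges \<Gamma>"
    "y # r \<in> arcs \<Gamma> n" "r = [] \<or> hd r \<noteq> x" using arcs_Suc_cases by metis
  have x_one: "a = y" if "{x, a} \<in> edges \<Gamma>" for a
  proof (rule ccontr)
    assume "a \<noteq> y"
    then have "a # p \<in> arcs \<Gamma> (Suc k)"
      using p that simple_graph_edgeD[OF S that] by (simp add: p' arcs_Cons insert_commute)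
    then show False using none by simp
  qed
  have one: "a = b" if va: "{v, a} \<in> edges \<Gamma>" and vb: "{v, b} \<in> edges \<Gamma>" for v a b
  proof -
    note V = simple_graph_edgeD[OF S va] simple_graph_edgeD[OF S vb]
    obtain g where "g \<in> G" and gv: "g v = x" using vt[OF V(1) x(1)] by blast
    then have g: "g \<in> carrier (graph_Aut \<Gamma>)" using G by blast
    then have "{g v, g a} \<in> edges \<Gamma>" "{g v, g b} \<in> edges \<Gamma>"
      using va vb V by (simp_all add: graph_Aut_def)
    then have "g a = g b" using x_one gv by metis
    then show "a = b" using graph_Aut_inj[OF g] V by (simp add: inj_on_eq_iff)
  qed
  have V: "vertices \<Gamma> = {x, y}"
    using two_vertices_if_valency_one[OF con S x(2)] one by metis
  then have "n \<noteq> 0" using K2 kn simple_graph_edgeD(3)[OF S x(2)] by auto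
  then obtain z t where z: "r = z # t" "{y, z} \<in> edges \<Gamma>"
    using x(3) by (cases n) (auto elim: arcs_Suc_cases)
  have "{y, x} \<in> edges \<Gamma>" using x(2) by (simp add: insert_commute)
  from one[OF this z(2)] show False using x(4) z(1) by simp
qed

text \<open>
  Local transitivity on 1-arcs of the subdivision gives the 1-arcs of \<open>\<Gamma>\<close>: at an edge it lets \<open>G\<close>
  walk from each vertex to its neighbours, at a vertex it permutes the neighbours. The stabiliser
  of an edge, through its action on arcs of length \<open>2k - 2\<close>, then gives the \<open>k\<close>-arcs for \<open>k \<ge> 2\<close>.
\<close>

lemma locally_imp_arc_transitive:
  assumes S: "simple_graph \<Gamma>" and con: "connected_graph \<Gamma>"
    and G: "subgroup G (graph_Aut \<Gamma>)" and s: "s \<ge> 1"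
    and K2: "\<not> (card (vertices \<Gamma>) = 2 \<and> s = 2)"
    and loc: "locally_arc_transitive (graph_Aut \<Gamma>\<lparr>carrier := G\<rparr>) (subdivision_action \<Gamma>)
      (subdivision \<Gamma>) s"
  shows "arc_transitive (graph_Aut \<Gamma>\<lparr>carrier := G\<rparr>) (\<lambda>g. g) \<Gamma> (s div 2 + 1)"
proof -
  let ?f = "subdivision_action \<Gamma>" and ?S = "subdivision \<Gamma>"
  note GA = subgroup.subset[OF G]
  have local: "\<exists>g\<in>G. map (?f g) q = q'"
    if "q \<in> arcs ?S i" "q' \<in> arcs ?S i" "hd q = hd q'" "1 \<le> i" "i \<le> s" for q q' i
  proof -
    have "hd q \<in> vertices ?S"
      using arcs_length[OF that(1)] arcs_vertices[OF that(1)] by (cases q) auto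
    then show ?thesis using loc that
      unfolding locally_arc_transitive_def transitive_on_tuples_def arcs_from_def stabilizer_def
      by fastforce
  qed
  have act: "?f g (Inl x) = Inl (g x)" if "x \<in> vertices \<Gamma>" for g x
    using that by (simp add: subdivision_action_def subdivision_simps)
  have actE: "?f g (Inr e) = Inr (g ` e)" if "e \<in> edges \<Gamma>" for g e
    using that by (simp add: subdivision_action_def subdivision_simps)
  have flip: "\<exists>g\<in>G. g x = y" if e: "{x, y} \<in> edges \<Gamma>" for x y
  proof -
    note V = simple_graph_edgeD[OF S e]
    have "\<exists>g\<in>G. map (?f g) [Inr {x, y}, Inl x] = [Inr {x, y}, Inl y]"
      by (rule local[of _ 1]) (use V e s in \<open>auto simp: arcs_Cons arcs_0 subdivision_simps\<close>)
    then show ?thesis using act V by auto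
  qed
  have pivot: "\<exists>g\<in>G. g x = x \<and> g y = z" if e: "{x, y} \<in> edges \<Gamma>" "{x, z} \<in> edges \<Gamma>" for x y z
  proof -
    note V = simple_graph_edgeD[OF S e(1)] simple_graph_edgeD[OF S e(2)]
    have "\<exists>g\<in>G. map (?f g) [Inl x, Inr {x, y}] = [Inl x, Inr {x, z}]"
      by (rule local[of _ 1]) (use V e s in \<open>auto simp: arcs_Cons arcs_0 subdivision_simps\<close>)
    then show ?thesis using act actE V e by (auto simp: doubleton_eq_iff)
  qed
  have vt: "\<exists>g\<in>G. g x = y" if xy: "x \<in> vertices \<Gamma>" "y \<in> vertices \<Gamma>" for x y
  proof -
    have "(x, y) \<in> {(x, y). {x, y} \<in> edges \<Gamma>}\<^sup>*"
      using con xy unfolding connected_graph_def by blast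
    then show ?thesis
    proof (induction rule: rtrancl_induct)
      case base
      have "\<one>\<^bsub>graph_Aut \<Gamma>\<^esub> \<in> G" using subgroup.one_closed[OF G] .
      moreover have "\<one>\<^bsub>graph_Aut \<Gamma>\<^esub> = (\<lambda>x\<in>vertices \<Gamma>. x)"
        by (simp add: graph_Aut_def BijGroup_def)
      ultimately show ?case using xy(1) by (metis restrict_apply')
    next
      case (step y z)
      then obtain g h where "g \<in> G" "g x = y" "h \<in> G" "h y = z" using flip by blast
      then show ?case using subgroup_graph_Aut_compose[OF G] xy(1) by metis
    qed
  qed
  have arc1: "\<exists>g\<in>G. g x = x' \<and> g y = y'" if e: "{x, y} \<in> edges \<Gamma>" "{x', y'} \<in> edges \<Gamma>" for x y x' y'
  proof -
    note V = simple_graph_edgeD[OF S e(1)] simple_graph_edgeD[OF S e(2)]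
    obtain g where g: "g \<in> G" "g x = x'" using vt V by blast
    then have "{x', g y} \<in> edges \<Gamma>" using GA V e by (auto simp: graph_Aut_def)
    then obtain h where "h \<in> G" "h x' = x'" "h (g y) = y'" using pivot e by blast
    then show ?thesis using subgroup_graph_Aut_compose[OF G g(1)] V g by metis
  qed
  have tr: "\<exists>g\<in>G. map g p = p'"
    if k: "1 \<le> k" "k \<le> s div 2 + 1" and p: "p \<in> arcs \<Gamma> k" "p' \<in> arcs \<Gamma> k" for k p p'
  proof -
    obtain n where kn: "k = Suc n" using k by (cases k) auto
    obtain x y r where px: "p = x # y # r" "{x, y} \<in> edges \<Gamma>"
      using p(1) kn arcs_Suc_cases by metis
    obtain x' y' r' where px': "p' = x' # y' # r'" "{x', y'} \<in> edges \<Gamma>"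
      using p(2) kn arcs_Suc_cases by metis
    obtain g where g: "g \<in> G" "g x = x'" "g y = y'" using arc1 px px' by blast
    show ?thesis
    proof (cases n)
      case 0
      then show ?thesis using g px px' arcs_length[OF p(1)] arcs_length[OF p(2)] kn by auto
    next
      case (Suc m)
      \<comment> \<open>The vertices at both ends of the subdivided \<open>k\<close>-arc are cut off: for even \<open>s\<close> and the
        largest \<open>k\<close>, keeping the last one would give an arc of length \<open>s + 1\<close>.\<close>
      define i where "i = 2 * n"
      have i: "1 \<le> i" "i \<le> s" using k kn Suc by (auto simp: i_def)
      have gp: "map g p \<in> arcs \<Gamma> k" using arcs_map[OF _ p(1)] g GA by blast
      have cut: "butlast (tl (subdivide p)) \<in> arcs ?S i"
        "hd (butlast (tl (subdivide p))) = Inr {hd p, hd (tl p)}"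
        if "p \<in> arcs \<Gamma> k" for p
      proof -
        obtain x y r where p: "p = x # y # r" using \<open>p \<in> arcs \<Gamma> k\<close> kn arcs_Suc_cases by metis
        obtain t where t: "subdivide (y # r) = Inl y # t" using subdivide_Cons by metis
        have "subdivide p \<in> arcs ?S (Suc (Suc i))"
          using subdivide_arcs[OF S \<open>p \<in> arcs \<Gamma> k\<close>] kn by (simp add: i_def)
        then have tl: "tl (subdivide p) \<in> arcs ?S (Suc i)" by (auto elim: arcs_Suc_cases)
        from arcs_take[OF this, of i] arcs_length[OF this]
        show "butlast (tl (subdivide p)) \<in> arcs ?S i" by (simp add: butlast_conv_take)
        show "hd (butlast (tl (subdivide p))) = Inr {hd p, hd (tl p)}" by (simp add: p t)
      qed
      obtain h where h: "h \<in> G"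
        "map (?f h) (butlast (tl (subdivide (map g p)))) = butlast (tl (subdivide p'))"
        using local[OF cut(1)[OF gp] cut(1)[OF p(2)] _ i]
          cut(2)[OF gp] cut(2)[OF p(2)] g px px' by auto
      have eq: "butlast (tl (subdivide (map h (map g p)))) = butlast (tl (subdivide p'))"
        using subdivide_map[OF gp, of h] h(2) by (metis map_butlast map_tl)
      have len: "length p = Suc k" "length p' = Suc k" using arcs_length p by blast+
      have hg: "map h (map g p) = p'"
        by (rule butlast_tl_subdivide_inject[OF _ _ eq]) (use len kn Suc in simp_all)
      obtain l where l: "l \<in> G" "\<And>x. x \<in> vertices \<Gamma> \<Longrightarrow> l x = h (g x)"
        using subgroup_graph_Aut_compose[OF G g(1) h(1)] by metis
      have "map l p = map h (map g p)"
        using l(2) arcs_vertices[OF p(1)] by auto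
      then show ?thesis using l(1) hg by metis
    qed
  qed
  have "arcs \<Gamma> (s div 2 + 1) \<noteq> {}"
  proof -
    obtain q where q: "q \<in> arcs ?S s"
      using loc by (auto simp: locally_arc_transitive_def arcs_from_def)
    then obtain w u where wu: "q = w # u" using arcs_length[OF q] by (cases q) auto
    show ?thesis
    proof (cases w)
      case (Inr e)
      then show ?thesis using arc_from_edge[OF S] q s wu by fastforce
    next
      case (Inl x)
      then obtain p where p: "p \<in> arcs \<Gamma> (Suc s div 2)"
        using arc_from_vertex[OF S] q wu by blast
      show ?thesis
      proof (cases "odd s")
        case True
        then show ?thesis using p by (auto elim!: oddE)
      next
        case False
        then obtain k where k: "s = 2 * k" by auto
        show ?thesis
          using vertex_transitive_arc_extend[OF con S GA vt, of p k] p k s K2 by auto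
      qed
    qed
  qed
  moreover have "transitive_on_tuples G (\<lambda>g. g) (arcs \<Gamma> k)" if "1 \<le> k" "k \<le> s div 2 + 1" for k
    unfolding transitive_on_tuples_def using tr[OF that] by blast
  ultimately show ?thesis by (simp add: arc_transitive_def)
qed

theorem theorem1p1:
  fixes \<Sigma> :: "'a graph" and G :: "('a \<Rightarrow> 'a) set" and s :: nat
  assumes "simple_graph \<Sigma>" and "connected_graph \<Sigma>"
    and "subgroup G (graph_Aut \<Sigma>)"
    and "s \<ge> 1"
    and "\<not> (card (vertices \<Sigma>) = 2 \<and> s = 2)"
  shows "locally_arc_transitive (graph_Aut \<Sigma>\<lparr>carrier := G\<rparr>) (subdivision_action \<Sigma>)
           (subdivision \<Sigma>) s
     \<longleftrightarrow> arc_transitive (graph_Aut \<Sigma>\<lparr>carrier := G\<rparr>) (\<lambda>g. g) \<Sigma> (nat \<lceil>(real s + 1) / 2\<rceil>)"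
proof -
  have "\<lceil>(real s + 1) / 2\<rceil> = int (s div 2 + 1)"
  proof (cases "even s")
    case True
    then obtain k where "s = 2 * k" by auto
    then show ?thesis by (intro ceiling_unique) auto
  next
    case False
    then obtain k where "s = 2 * k + 1" by (auto elim: oddE)
    then show ?thesis by (intro ceiling_unique) auto
  qed
  then have "nat \<lceil>(real s + 1) / 2\<rceil> = s div 2 + 1" by simp
  then show ?thesis
    using arc_transitive_imp_locally[OF assms(1,3,4)] locally_imp_arc_transitive[OF assms]
    by metis
qed

end
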